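(* Let $\alpha\in(0,1]$. If $m>1$, then eBH+ uniformly improves eBH; that is: (1) for every vector of $e$-values $(e_1,\dots,e_m)\in[0,\infty)^m$, the set rejected by eBH belongs to the collection of sets rejected by eBH+; and (2) there is a vector of $e$-values $(e_1,\dots,e_m)\in[0,\infty)^m$ for which some set $R$ in the collection rejected by eBH+ is a strict superset of the set rejected by eBH.
   Context: Setting: $\mathbf{e}_1,\dots,\mathbf{e}_m$ are $e$-values for hypotheses $H_1,\dots,H_m$ (nonnegative random variables, with $\mathbf{e}_i$ having expectation at most $1$ under every probability measure in $H_i$), with no assumption on their joint distribution. $[m]=\{1,\dots,m\}$, $\mathcal{M}=2^{[m]}\setminus\{\emptyset\}$, $a\vee b=\max(a,b)$. Both procedures below are functions of the realized vector $(e_1,\dots,e_m)\in[0,\infty)^m$. eBH at level $\alpha$: let $e_{(1)}\ge\dots\ge e_{(m)}$ be the values sorted in decreasing order, and $r_\alpha=\max\{1\le r\le m: r\,e_{(r)}\ge m/\alpha\}$, or $r_\alpha=0$ if no such $r$ exists. eBH rejects the set of indices of the $r_\alpha$ largest $e$-values, i.e. $R_\alpha=\{i: e_i\ge e_{(r_\alpha)}\}$ if $r_\alpha\ge1$ and $R_\alpha=\emptyset$ if $r_\alpha=0$. eBH+ at level $\alpha$ rejects the collection of sets $$\Big\{R\in 2^{[m]}:\ \frac{\alpha}{|S|}\sum_{i\in S}e_i\ge\frac{|R\cap S|}{|R|\vee1}\ \text{for all }S\in\mathcal{M}\Big\}.$$ Uniform improvement (defined for procedures that control the false discovery rate at level $\alpha$,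 as both of these do): a collection-valued procedure $\boldsymbol{\mathcal{R}}$ uniformly improves a set-valued procedure $\mathbf{S}$ if (1) $\mathbf{S}\in\boldsymbol{\mathcal{R}}$ always, and (2) there is an event (here: a possible realization of the $e$-values) on which $\mathbf{S}\subsetneq R$ for some $R\in\boldsymbol{\mathcal{R}}$. *)

theory Defs
  imports Complex_Main "HOL-Library.FuncSet"
begin

(* Realizations of m e-values: the vectors in [0, infinity)^m, indexed by {1..m}
   (extensional functions, so that each vector is represented exactly once). *)
definition evectors :: "nat \<Rightarrow> (nat \<Rightarrow> real) set" where
  "evectors m = {1..m} \<rightarrow>\<^sub>E {0..}"

(* The r-th largest of e 1, ..., e m, counted with multiplicity; meaningful for 1 <= r <= m only. *)
definition order_stat :: "nat \<Rightarrow> (nat \<Rightarrow> real) \<Rightarrow> nat \<Rightarrow> real" where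
  "order_stat m e r = rev (sort (map e [1..<Suc m])) ! (r - 1)"

definition eBH_candidates :: "nat \<Rightarrow> real \<Rightarrow> (nat \<Rightarrow> real) \<Rightarrow> nat set" where
  "eBH_candidates m \<alpha> e = {r \<in> {1..m}. real r * order_stat m e r \<ge> real m / \<alpha>}"

definition eBH_number :: "nat \<Rightarrow> real \<Rightarrow> (nat \<Rightarrow> real) \<Rightarrow> nat" where
  "eBH_number m \<alpha> e =
     (if eBH_candidates m \<alpha> e = {} then 0 else Max (eBH_candidates m \<alpha> e))"

definition eBH :: "nat \<Rightarrow> real \<Rightarrow> (nat \<Rightarrow> real) \<Rightarrow> nat set" where
  "eBH m \<alpha> e =
     (if eBH_number m \<alpha> e = 0 then {}
      else {i \<in> {1..m}. e i \<ge> order_stat m e (eBH_number m \<alpha> e)})"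

definition eBH_plus :: "nat \<Rightarrow> real \<Rightarrow> (nat \<Rightarrow> real) \<Rightarrow> nat set set" where
  "eBH_plus m \<alpha> e =
     {R \<in> Pow {1..m}. \<forall>S \<in> Pow {1..m} - {{}}.
        \<alpha> / real (card S) * (\<Sum>i\<in>S. e i) \<ge> real (card (R \<inter> S)) / real (max (card R) 1)}"

(* Both procedures are functions of the realized e-values, so "always" and
   "there is an event on which" range over realizations. *)
definition uniformly_improves ::
  "nat \<Rightarrow> ((nat \<Rightarrow> real) \<Rightarrow> nat set set) \<Rightarrow> ((nat \<Rightarrow> real) \<Rightarrow> nat set) \<Rightarrow> bool" where
  "uniformly_improves m RR T \<longleftrightarrow>
     (\<forall>e \<in> evectors m. T e \<in> RR e) \<and>
     (\<exists>e \<in> evectors m. \<exists>R \<in> RR e. T e \<subset> R)"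

end

theory Submission
  imports Defs
begin

text \<open>
  With \<open>r\<close> and \<open>R\<close> the number and set found by eBH, every \<open>i \<in> R\<close> has
  \<open>\<alpha> e\<^sub>i \<ge> m / r \<ge> |S| / |R|\<close>, and summing over \<open>R \<inter> S\<close> gives the eBH+ condition.
  For strictness take \<open>e\<^sub>1 = (m + 1) / (2 \<alpha>)\<close> and all other \<open>e\<^sub>i = 1 / (2 \<alpha>)\<close>: eBH rejects nothing,
  but any \<open>S\<close> containing \<open>1\<close> has \<open>\<alpha> \<Sum>\<^sub>S e = (m + |S|) / 2 \<ge> |S|\<close>, so eBH+ rejects \<open>{1}\<close>.
\<close>

text \<open>The first \<open>r\<close> entries of the decreasing list are at least its
  \<open>r\<close>-th entry, and sorting or reversing does not change how many entries pass a
  filter. Ties at the \<open>r\<close>-th value can make the inequality strict.\<close>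

lemma card_ge_order_stat:
  assumes "1 \<le> r" "r \<le> m"
  shows "r \<le> card {i \<in> {1..m}. e i \<ge> order_stat m e r}"
proof -
  let ?xs = "rev (sort (map e [1..<Suc m]))"
  let ?P = "\<lambda>x. x \<ge> order_stat m e r"
  have "\<forall>x \<in> set (take r ?xs). ?P x"
    using assms by (auto simp: in_set_conv_nth order_stat_def intro!: sorted_rev_nth_mono) linarith+
  then have "r = length (filter ?P (take r ?xs))"
    using assms by (simp add: filter_id_conv[THEN iffD2])
  also have "\<dots> \<le> length (filter ?P (take r ?xs @ drop r ?xs))"
    by (simp only: filter_append length_append)
  also have "\<dots> = length (filter ?P ?xs)"
    by (simp only: append_take_drop_id)
  also have "\<dots> = length (filter (?P \<circ> e) [1..<Suc m])"
    by (simp only: rev_filter[symmetric] length_rev filter_sort length_sort filter_map length_map)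
  also have "\<dots> = card (set (filter (?P \<circ> e) [1..<Suc m]))"
    by (intro distinct_card[symmetric] distinct_filter distinct_upt)
  also have "set (filter (?P \<circ> e) [1..<Suc m]) = {i \<in> {1..m}. ?P (e i)}"
    by auto
  finally show ?thesis .
qed

lemma eBH_in_eBH_plus:
  assumes e: "e \<in> evectors m" and \<alpha>: "0 < \<alpha>"
  shows "eBH m \<alpha> e \<in> eBH_plus m \<alpha> e"
proof (cases "eBH_number m \<alpha> e = 0")
  case True
  \<comment> \<open>The rejected set is empty, so the left side of each eBH+ condition is 0 and
    nonnegativity of the sums suffices.\<close>
  have "0 \<le> sum e S" if "S \<subseteq> {1..m}" for S
    using e that by (intro sum_nonneg) (auto simp: evectors_def)
  with True \<alpha> show ?thesis
    by (auto simp: eBH_def eBH_plus_def)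
next
  case False
  define r where "r = eBH_number m \<alpha> e"
  define R where "R = {i \<in> {1..m}. e i \<ge> order_stat m e r}"
  have "finite (eBH_candidates m \<alpha> e)" "eBH_candidates m \<alpha> e \<noteq> {}"
    using False by (simp add: eBH_candidates_def, simp add: eBH_number_def split: if_splits)
  then have "r \<in> eBH_candidates m \<alpha> e"
    using Max_in by (auto simp: r_def eBH_number_def)
  then have r: "1 \<le> r" "r \<le> m" "real m / \<alpha> \<le> real r * order_stat m e r"
    by (auto simp: eBH_candidates_def)
  have rR: "r \<le> card R"
    using card_ge_order_stat r by (auto simp: R_def)
  have "real (card (R \<inter> S)) / real (max (card R) 1) \<le> \<alpha> / real (card S) * sum e S"
    if S: "S \<subseteq> {1..m}" "S \<noteq> {}" for S
  proof -
    have fin: "finite S"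
      using S finite_subset by blast
    have cS: "0 < card S" "card S \<le> m"
      using S fin card_mono[of "{1..m}" S] by (auto simp: card_gt_0_iff)
    \<comment> \<open>Ties can only make \<open>card R\<close> exceed \<open>r\<close>, which lowers
      the left side further.\<close>
    have "real (card S) / real (card R) \<le> real m / real r"
      using cS r rR by (intro frac_le) auto
    also have "\<dots> \<le> \<alpha> * order_stat m e r"
      using r \<alpha> by (simp add: field_simps)
    finally have "real (card S) / real (card R) \<le> \<alpha> * e i" if "i \<in> R" for i
      using that \<alpha> by (auto simp: R_def intro: order_trans mult_left_mono)
    then have "real (card (R \<inter> S)) * (real (card S) / real (card R)) \<le> (\<Sum>i\<in>R \<inter> S. \<alpha> * e i)"
      by (intro sum_bounded_below) auto
    \<comment> \<open>The indices of \<open>S\<close> outside \<open>R\<close> contribute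
      nonnegative terms.\<close>
    also have "\<dots> \<le> (\<Sum>i\<in>S. \<alpha> * e i)"
      using e S fin \<alpha> by (intro sum_mono2) (auto simp: evectors_def intro!: mult_nonneg_nonneg)
    finally show ?thesis
      using cS r rR by (simp add: sum_distrib_left[symmetric] field_simps max_absorb1)
  qed
  with False show ?thesis
    by (auto simp: eBH_plus_def eBH_def R_def r_def)
qed

lemma eBH_plus_improvement_witness:
  assumes \<alpha>: "0 < \<alpha>" and m: "1 < m"
  defines "e \<equiv> (\<lambda>i\<in>{1..m}. if i = 1 then (real m + 1) / (2 * \<alpha>) else 1 / (2 * \<alpha>))"
  shows "eBH m \<alpha> e = {}" and "{1} \<in> eBH_plus m \<alpha> e"
proof -
  have "eBH_candidates m \<alpha> e = {}"
  proof (rule ccontr)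
    assume "eBH_candidates m \<alpha> e \<noteq> {}"
    then obtain r where r: "1 \<le> r" "r \<le> m" "real m / \<alpha> \<le> real r * order_stat m e r"
      by (auto simp: eBH_candidates_def)
    have card: "r \<le> card {i \<in> {1..m}. e i \<ge> order_stat m e r}"
      using card_ge_order_stat r by blast
    show False
    proof (cases "r = 1")
      case True
      \<comment> \<open>Here \<open>m > 1\<close> enters: (m + 1) / 2 < m, so even the largest value
        misses the threshold for \<open>r = 1\<close>.\<close>
      have "(real m + 1) / (2 * \<alpha>) < real m / \<alpha>"
        using \<alpha> m by (simp add: field_simps)
      moreover have "e i \<le> (real m + 1) / (2 * \<alpha>)" if "i \<in> {1..m}" for i
        using that \<alpha> by (auto simp: e_def field_simps)
      ultimately have "{i \<in> {1..m}. e i \<ge> order_stat m e r} = {}"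
        using r True by fastforce
      with card True show False
        by (metis card.empty not_one_le_zero)
    next
      case False
      \<comment> \<open>Since r \<le> m < 2 m, the small values stay below the threshold m / (r
        \<alpha>). Only index 1 can reach it, whereas at least \<open>r\<close>, hence two, indices
        would have to.\<close>
      have "real r * (1 / (2 * \<alpha>)) < real m / \<alpha>"
        using \<alpha> m r by (simp add: field_simps)
      also note r(3)
      finally have "1 / (2 * \<alpha>) < order_stat m e r"
        using r(1) by (simp add: mult_less_cancel_left_pos del: times_divide_eq_right)
      then have "{i \<in> {1..m}. e i \<ge> order_stat m e r} \<subseteq> {1}"
        by (auto simp: e_def split: if_splits)
      then have "card {i \<in> {1..m}. e i \<ge> order_stat m e r} \<le> card {1 :: nat}"
        by (intro card_mono) auto
      with card False r show False
        by simp
    qed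
  qed
  then show "eBH m \<alpha> e = {}"
    by (simp add: eBH_def eBH_number_def)
  \<comment> \<open>For the singleton, the denominator \<open>max (card R) 1\<close> of the eBH+
    condition is 1.\<close>
  have "real (card ({1} \<inter> S)) \<le> \<alpha> / real (card S) * sum e S"
    if S: "S \<subseteq> {1..m}" "S \<noteq> {}" for S
  proof (cases "1 \<in> S")
    case True
    have fin: "finite S"
      using S finite_subset by blast
    have cS: "0 < card S" "card S \<le> m"
      using S fin card_mono[of "{1..m}" S] by (auto simp: card_gt_0_iff)
    have "sum e S = e 1 + sum e (S - {1})"
      using True fin by (simp add: sum.remove)
    also have "sum e (S - {1}) = (\<Sum>i\<in>S - {1}. 1 / (2 * \<alpha>))"
      using S by (intro sum.cong) (auto simp: e_def)
    \<comment> \<open>The m + 1 from index 1 and the \<open>card S - 1\<close> ones from the rest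
      add up to m + |S|, which is at least 2 |S| because |S| \<le> m.\<close>
    also have "e 1 + \<dots> = (real m + real (card S)) / (2 * \<alpha>)"
      using True fin m cS by (simp add: e_def of_nat_diff add_divide_distrib[symmetric])
    finally show ?thesis
      using True \<alpha> cS by (simp add: field_simps)
  next
    case False
    have "0 \<le> sum e S"
      using S \<alpha> by (intro sum_nonneg) (auto simp: e_def)
    with False \<alpha> show ?thesis
      by simp
  qed
  with m show "{1} \<in> eBH_plus m \<alpha> e"
    by (auto simp: eBH_plus_def)
qed

theorem theorem2:
  fixes m :: nat and \<alpha> :: real
  assumes "\<alpha> \<in> {0<..1}"
    and "m > 1"
  shows "uniformly_improves m (eBH_plus m \<alpha>) (eBH m \<alpha>)"
proof -
  let ?e = "\<lambda>i\<in>{1..m}. if i = 1 then (real m + 1) / (2 * \<alpha>) else 1 / (2 * \<alpha>)"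
  have \<alpha>: "0 < \<alpha>"
    using assms by simp
  then have "?e \<in> evectors m"
    by (auto simp: evectors_def)
  moreover have "eBH m \<alpha> ?e \<subset> {1}"
    unfolding eBH_plus_improvement_witness(1)[OF \<alpha> assms(2)] by auto
  ultimately show ?thesis
    unfolding uniformly_improves_def
    using eBH_in_eBH_plus eBH_plus_improvement_witness(2)[OF \<alpha> assms(2)] \<alpha> by blast
qed

end
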